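(* Let $V$ be a finite set, let $X\colon\mathcal{P}(V)^{\mathrm{op}}\to\{0,1\}$ be a simplicial complex over $V$, let $n\ge 1$ be an integer, and let $X^{\mathrm{op}}\colon\mathcal{P}(V)\to\{0,1\}^{\mathrm{op}}$ be its opposite functor. Then $X^{\mathrm{op}}$ is codegree $n$ if and only if $X$ is $(n-1)$-coskeletal.
   Context: $\mathcal{P}(V)$ is the power set of $V$ ordered by inclusion and $\{0,1\}$ is the poset with $0<1$. A simplicial complex over $V$ is a subset of $\mathcal{P}(V)$ containing $\emptyset$ and closed under taking subsets; equivalently it is a functor $X\colon\mathcal{P}(V)^{\mathrm{op}}\to\{0,1\}$ with $X(\emptyset)=1$, where $X(\sigma)=1$ means $\sigma$ is a simplex. The $m$-skeleton $X_{\le m}$ is the subcomplex of simplices $\sigma$ with $|\sigma|\le m+1$. $X$ is $m$-coskeletal if it is the maximal simplicial complex (over $V$) having $X_{\le m}$ as its $m$-skeleton; that is, every $\sigma\subseteq V$ all of whose subsets of cardinality $\le m+1$ are in $X$ is itself in $X$. Codegree for functors into an ordinary cocomplete category $C$ (here the complete lattice $\{0,1\}^{\mathrm{op}}$, where colimits are joins): let $[n]=\{0,\dots,n\}$ and $\mathcal{P}_{n+1}$ the power set of $[n]$ ordered by inclusion; an $(n+1)$-cube in a category is a functor $\mathcal{X}$ out of $\mathcal{P}_{n+1}$. It is cocartesian if $\operatorname{colim}_{S\subsetneq[n]}\mathcal{X}(S)\to\mathcal{X}([n])$ is an isomorphism, cartesian if $\mathcal{X}(\emptyset)\to\lim_{\emptyset\neq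 S\subseteq[n]}\mathcal{X}(S)$ is an isomorphism, and strongly bicartesian if every face of dimension $\ge 2$ is both cartesian and cocartesian. A functor $F\colon P\to C$ from a lattice is codegree $n$ if it sends strongly bicartesian $(n+1)$-cubes in $P$ to cocartesian cubes in $C$. *)

theory Defs
  imports "HOL-Library.Lub_Glb" "HOL-Library.Dual_Ordered_Lattice"
begin

section \<open>Cubes in posets and codegree\<close>

text \<open>
  A poset, viewed as a category, is given by a carrier set \<open>P\<close> in a type of class \<open>order\<close>; functors
  are monotone maps.  The colimit (limit) in \<open>P\<close> of a diagram is the least upper (greatest lower)
  bound of its image, taken relative to \<open>P\<close>, and isomorphisms are equalities.

  Cubes are indexed by the subsets of an arbitrary set \<open>J\<close>, so that faces of cubes are again cubes;
  the \<open>(n+1)\<close>-cubes are those with \<open>J = {..n}\<close>.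
\<close>

definition cube :: "'p::order set \<Rightarrow> nat set \<Rightarrow> (nat set \<Rightarrow> 'p) \<Rightarrow> bool" where
  "cube P J \<chi> \<longleftrightarrow> \<chi> ` Pow J \<subseteq> P \<and> mono_on (Pow J) \<chi>"

definition cocartesian :: "'p::order set \<Rightarrow> nat set \<Rightarrow> (nat set \<Rightarrow> 'p) \<Rightarrow> bool" where
  "cocartesian P J \<chi> \<longleftrightarrow> isLub P (\<chi> ` {S. S \<subset> J}) (\<chi> J)"

definition cartesian :: "'p::order set \<Rightarrow> nat set \<Rightarrow> (nat set \<Rightarrow> 'p) \<Rightarrow> bool" where
  "cartesian P J \<chi> \<longleftrightarrow> isGlb P (\<chi> ` {S. S \<noteq> {} \<and> S \<subseteq> J}) (\<chi> {})"

text \<open>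
  The face of \<open>\<chi>\<close> spanned by \<open>A \<subseteq> B \<subseteq> J\<close>, i.e. the restriction of \<open>\<chi>\<close> to the interval from \<open>A\<close> to
  \<open>B\<close>, is the cube \<open>face A \<chi>\<close> indexed by the subsets of \<open>B - A\<close>; its dimension is \<open>card (B - A)\<close>.
\<close>

definition face :: "nat set \<Rightarrow> (nat set \<Rightarrow> 'p) \<Rightarrow> nat set \<Rightarrow> 'p" where
  "face A \<chi> = (\<lambda>T. \<chi> (A \<union> T))"

definition strongly_bicartesian :: "'p::order set \<Rightarrow> nat set \<Rightarrow> (nat set \<Rightarrow> 'p) \<Rightarrow> bool" where
  "strongly_bicartesian P J \<chi> \<longleftrightarrow>
     cube P J \<chi> \<and>
     (\<forall>A B. A \<subseteq> B \<and> B \<subseteq> J \<and> card (B - A) \<ge> 2 \<longrightarrow>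
        cartesian P (B - A) (face A \<chi>) \<and> cocartesian P (B - A) (face A \<chi>))"

definition codegree :: "'p::order set \<Rightarrow> nat \<Rightarrow> ('p \<Rightarrow> 'c::complete_lattice) \<Rightarrow> bool" where
  "codegree P n F \<longleftrightarrow>
     mono_on P F \<and>
     (\<forall>\<chi>. strongly_bicartesian P {..n} \<chi> \<longrightarrow> cocartesian UNIV {..n} (F \<circ> \<chi>))"


section \<open>Simplicial complexes\<close>

text \<open>
  The poset \<open>{0,1}\<close> is \<^typ>\<open>bool\<close>.  Only the values of a complex on \<open>Pow V\<close> are meaningful.
\<close>

definition simplicial_complex :: "'a set \<Rightarrow> ('a set \<Rightarrow> bool) \<Rightarrow> bool" where
  "simplicial_complex V X \<longleftrightarrow> antimono_on (Pow V) X \<and> X {}"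

definition skeleton :: "nat \<Rightarrow> ('a set \<Rightarrow> bool) \<Rightarrow> 'a set \<Rightarrow> bool" where
  "skeleton m X = (\<lambda>\<sigma>. X \<sigma> \<and> finite \<sigma> \<and> card \<sigma> \<le> m + 1)"

definition coskeletal :: "'a set \<Rightarrow> nat \<Rightarrow> ('a set \<Rightarrow> bool) \<Rightarrow> bool" where
  "coskeletal V m X \<longleftrightarrow>
     simplicial_complex V X \<and>
     (\<forall>Y. simplicial_complex V Y \<and> (\<forall>\<sigma>\<in>Pow V. skeleton m Y \<sigma> = skeleton m X \<sigma>) \<longrightarrow>
        (\<forall>\<sigma>\<in>Pow V. Y \<sigma> \<le> X \<sigma>))"

lemma coskeletal_iff:
  assumes X: "simplicial_complex V X"
  shows "coskeletal V m X \<longleftrightarrow>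
    (\<forall>\<sigma>\<subseteq>V. (\<forall>\<tau>\<subseteq>\<sigma>. finite \<tau> \<and> card \<tau> \<le> m + 1 \<longrightarrow> X \<tau>) \<longrightarrow> X \<sigma>)"
    (is "_ \<longleftrightarrow> ?R")
proof
  assume cosk: "coskeletal V m X"
  define Y where "Y = (\<lambda>\<sigma>. \<forall>\<tau>\<subseteq>\<sigma>. finite \<tau> \<and> card \<tau> \<le> m + 1 \<longrightarrow> X \<tau>)"
  have "simplicial_complex V Y"
    using X by (auto simp: simplicial_complex_def Y_def monotone_on_def)
  moreover have "skeleton m Y \<sigma> = skeleton m X \<sigma>" if "\<sigma> \<in> Pow V" for \<sigma>
  proof -
    have "X \<tau>" if "X \<sigma>" "\<tau> \<subseteq> \<sigma>" for \<tau>
      using X that \<open>\<sigma> \<in> Pow V\<close> unfolding simplicial_complex_def monotone_on_def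
      by (metis Pow_iff le_boolE order_trans)
    then show ?thesis by (auto simp: skeleton_def Y_def)
  qed
  ultimately have "\<forall>\<sigma>\<in>Pow V. Y \<sigma> \<le> X \<sigma>"
    using cosk unfolding coskeletal_def by blast
  then show ?R by (auto simp: Y_def)
next
  assume R: ?R
  show "coskeletal V m X"
    unfolding coskeletal_def
  proof (intro conjI allI impI ballI X)
    fix Y \<sigma>
    assume Y: "simplicial_complex V Y \<and> (\<forall>\<sigma>\<in>Pow V. skeleton m Y \<sigma> = skeleton m X \<sigma>)"
      and \<sigma>: "\<sigma> \<in> Pow V"
    have "X \<tau>" if "Y \<sigma>" "\<tau> \<subseteq> \<sigma>" "finite \<tau>" "card \<tau> \<le> m + 1" for \<tau>
    proof -
      have "Y \<tau>"
        using Y \<sigma> that unfolding simplicial_complex_def monotone_on_def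
        by (metis Pow_iff le_boolE order_trans)
      then have "skeleton m Y \<tau>" using that by (simp add: skeleton_def)
      moreover have "\<tau> \<in> Pow V" using that \<sigma> by auto
      ultimately show ?thesis using Y by (auto simp: skeleton_def)
    qed
    then show "Y \<sigma> \<le> X \<sigma>" using R \<sigma> by auto
  qed
qed

definition opposite_functor :: "('a set \<Rightarrow> bool) \<Rightarrow> 'a set \<Rightarrow> bool dual" where
  "opposite_functor X = (\<lambda>\<sigma>. dual (X \<sigma>))"

end

theory Submission
  imports Defs
begin

text \<open>
  In a strongly cocartesian \<open>(n+1)\<close>-cube of sets, every point of a vertex already lies in a vertex
  indexed by at most one element.  Hence at most \<open>n\<close> points of the last vertex lie in a common
  earlier vertex, which gives codegree \<open>n\<close> for an \<open>(n-1)\<close>-coskeletal complex.  Conversely, splitting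
  a set \<open>\<sigma>\<close> of more than \<open>n\<close> points into \<open>n + 1\<close> nonempty blocks gives a strongly bicartesian cube of
  unions of blocks, whose last vertex is \<open>\<sigma>\<close> and whose other vertices are proper subsets of \<open>\<sigma>\<close>; so
  induction on \<open>card \<sigma>\<close> applies.
\<close>

lemma isLubI:
  assumes "u \<in> P" "\<And>y. y \<in> A \<Longrightarrow> y \<le> u"
    and "\<And>w. w \<in> P \<Longrightarrow> (\<And>y. y \<in> A \<Longrightarrow> y \<le> w) \<Longrightarrow> u \<le> w"
  shows "isLub P A u"
  using assms by (simp add: isLub_def leastP_def isUb_def setle_def setge_def)

lemma isGlbI:
  assumes "u \<in> P" "\<And>y. y \<in> A \<Longrightarrow> u \<le> y"
    and "\<And>w. w \<in> P \<Longrightarrow> (\<And>y. y \<in> A \<Longrightarrow> w \<le> y) \<Longrightarrow> w \<le> u"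
  shows "isGlb P A u"
  using assms by (simp add: isGlb_def greatestP_def isLb_def setle_def setge_def)

text \<open>Joins in \<open>bool dual\<close> are meets in \<open>bool\<close>, so the colimit over
  the proper subsets of \<open>J\<close> becomes a conjunction.\<close>

lemma cocartesian_opposite_functor_iff:
  "cocartesian UNIV J (opposite_functor X \<circ> \<chi>) \<longleftrightarrow> (X (\<chi> J) \<longleftrightarrow> (\<forall>S\<subset>J. X (\<chi> S)))"
proof -
  have "isLub UNIV A u \<longleftrightarrow> u = Sup A" for A and u :: "bool dual"
  proof -
    have Sup: "isLub UNIV A (Sup A)"
      by (intro isLubI UNIV_I Sup_upper Sup_least)
    then show ?thesis
      using isLub_le_isUb[OF _ isLub_isUb] antisym by metis
  qed
  then have "cocartesian UNIV J (opposite_functor X \<circ> \<chi>)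
      \<longleftrightarrow> dual (X (\<chi> J)) = (SUP S\<in>{S. S \<subset> J}. dual (X (\<chi> S)))"
    by (simp add: cocartesian_def opposite_functor_def image_image)
  also have "(SUP S\<in>{S. S \<subset> J}. dual (X (\<chi> S))) = dual (INF S\<in>{S. S \<subset> J}. X (\<chi> S))"
    by (simp only: dual_Inf_eq image_image)
  finally show ?thesis by (simp add: comp_def)
qed

lemma strongly_bicartesian_vertex:
  "strongly_bicartesian P J \<chi> \<Longrightarrow> S \<subseteq> J \<Longrightarrow> \<chi> S \<in> P"
  by (simp add: strongly_bicartesian_def cube_def image_subset_iff)

lemma strongly_bicartesian_mono:
  "strongly_bicartesian P J \<chi> \<Longrightarrow> A \<subseteq> B \<Longrightarrow> B \<subseteq> J \<Longrightarrow> \<chi> A \<le> \<chi> B"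
  by (simp add: strongly_bicartesian_def cube_def monotone_on_def)

lemma strongly_bicartesian_isLub:
  assumes "strongly_bicartesian P J \<chi>" "S \<subseteq> J" "2 \<le> card S"
  shows "isLub P (\<chi> ` {T. T \<subset> S}) (\<chi> S)"
proof -
  have "cocartesian P (S - {}) (face {} \<chi>)"
    using assms unfolding strongly_bicartesian_def by (metis Diff_empty empty_subsetI)
  then show ?thesis by (simp add: cocartesian_def face_def)
qed

text \<open>As long as \<open>S\<close> has at least two elements, the subcube below it is
  cocartesian, so \<open>x\<close> already lies in a vertex with a smaller index set. The descent
  stops at \<open>card T \<le> 1\<close>, because faces of dimension below 2 carry no
  condition.\<close>

lemma strongly_bicartesian_Pow_vertexE:
  assumes \<chi>: "strongly_bicartesian (Pow V) J \<chi>" and "finite J" "S \<subseteq> J" "x \<in> \<chi> S"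
  obtains T where "T \<subseteq> S" "card T \<le> 1" "x \<in> \<chi> T"
proof -
  have "finite S" using assms finite_subset by blast
  then have "\<exists>T\<subseteq>S. card T \<le> 1 \<and> x \<in> \<chi> T"
    using assms(3,4)
  proof (induction S rule: finite_psubset_induct)
    case (psubset S)
    show ?case
    proof (cases "card S \<le> 1")
      case False
      then have lub: "isLub (Pow V) (\<chi> ` {T. T \<subset> S}) (\<chi> S)"
        using strongly_bicartesian_isLub[OF \<chi> psubset.prems(1)] by simp
      have "\<chi> T \<subseteq> V" if "T \<subseteq> J" for T
        using strongly_bicartesian_vertex[OF \<chi> that] by simp
      then have "\<chi> T \<subseteq> V" if "T \<subset> S" for T
        using that psubset.prems(1) by (meson psubsetE subset_trans)
      \<comment> \<open>The union of the earlier vertices stays inside \<open>V\<close>, so it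
        competes with the least upper bound taken relative to \<open>Pow V\<close>.\<close>
      then have "isUb (Pow V) (\<chi> ` {T. T \<subset> S}) (\<Union>T\<in>{T. T \<subset> S}. \<chi> T)"
        by (intro isUbI setleI) auto
      with lub have "\<chi> S \<subseteq> (\<Union>T\<in>{T. T \<subset> S}. \<chi> T)"
        by (rule isLub_le_isUb)
      then have "x \<in> (\<Union>T\<in>{T. T \<subset> S}. \<chi> T)" using psubset.prems(2) by (rule subsetD)
      then obtain T where "T \<subset> S" "x \<in> \<chi> T" by auto
      then show ?thesis using psubset.IH[of T] psubset.prems by blast
    qed (use psubset.prems in blast)
  qed
  then show thesis using that by blast
qed

text \<open>Each point of \<open>\<tau>\<close> needs at most one index, so all of them together
  need at most \<open>n\<close> of the \<open>n + 1\<close> indices; the union of these index sets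
  is a proper subset.\<close>

lemma strongly_bicartesian_Pow_cover:
  assumes \<chi>: "strongly_bicartesian (Pow V) {..n} \<chi>"
    and \<tau>: "\<tau> \<subseteq> \<chi> {..n}" "finite \<tau>" "card \<tau> \<le> n"
  obtains S where "S \<subset> {..n}" "\<tau> \<subseteq> \<chi> S"
proof -
  have "\<exists>T\<subseteq>{..n}. card T \<le> 1 \<and> x \<in> \<chi> T" if "x \<in> \<tau>" for x
  proof -
    have "x \<in> \<chi> {..n}" using \<tau>(1) that by (rule subsetD)
    then show ?thesis
      by (rule strongly_bicartesian_Pow_vertexE[OF \<chi> finite_atMost subset_refl]) (intro exI conjI)
  qed
  then obtain T where T: "\<And>x. x \<in> \<tau> \<Longrightarrow> T x \<subseteq> {..n} \<and> card (T x) \<le> 1 \<and> x \<in> \<chi> (T x)"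
    by metis
  let ?S = "\<Union>x\<in>\<tau>. T x"
  have sub: "?S \<subseteq> {..n}" using T by auto
  have "card ?S \<le> (\<Sum>x\<in>\<tau>. card (T x))" using \<tau>(2) by (rule card_UN_le)
  also have "\<dots> \<le> (\<Sum>x\<in>\<tau>. 1)" using T by (intro sum_mono) auto
  also have "\<dots> < card {..n}" using \<tau>(3) by simp
  finally have proper: "?S \<subset> {..n}" using sub by auto
  have "\<chi> (T x) \<subseteq> \<chi> ?S" if "x \<in> \<tau>" for x
    using strongly_bicartesian_mono[OF \<chi> _ sub] that by (simp add: UN_upper)
  then have "\<tau> \<subseteq> \<chi> ?S" using T by (meson subsetD subsetI)
  with proper show thesis by (rule that)
qed

text \<open>The map \<open>g\<close> labels points, and the vertex at \<open>S\<close> collects the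
  points of \<open>\<sigma>\<close> with label in \<open>S\<close>. Preimages preserve unions and
  intersections, so \<open>g\<close> can be arbitrary here; surjectivity matters only when vertices
  must be proper subsets of \<open>\<sigma>\<close>.\<close>

lemma strongly_bicartesian_vimage:
  assumes "\<sigma> \<subseteq> V"
  shows "strongly_bicartesian (Pow V) J (\<lambda>S. \<sigma> \<inter> g -` S)"
    (is "strongly_bicartesian _ _ ?\<chi>")
proof -
  have "cartesian (Pow V) (B - A) (face A ?\<chi>) \<and> cocartesian (Pow V) (B - A) (face A ?\<chi>)"
    if "A \<subseteq> B" "2 \<le> card (B - A)" for A B
  proof
    obtain i j where ij: "i \<in> B - A" "j \<in> B - A" "i \<noteq> j"
      using \<open>2 \<le> card (B - A)\<close> by (auto simp: numeral_2_eq_2 card_le_Suc_iff)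
    show "cartesian (Pow V) (B - A) (face A ?\<chi>)"
      unfolding cartesian_def face_def
    proof (rule isGlbI)
      fix U
      assume U: "\<And>Y. Y \<in> (\<lambda>T. ?\<chi> (A \<union> T)) ` {S. S \<noteq> {} \<and> S \<subseteq> B - A} \<Longrightarrow> U \<le> Y"
      \<comment> \<open>Two distinct directions suffice: a label in both
        \<open>A \<union> {i}\<close> and \<open>A \<union> {j}\<close> lies in
        \<open>A\<close>.\<close>
      have "U \<subseteq> ?\<chi> (A \<union> {i})" "U \<subseteq> ?\<chi> (A \<union> {j})"
        by (intro U imageI CollectI; use ij in simp)+
      then have "U \<subseteq> ?\<chi> (A \<union> {i}) \<inter> ?\<chi> (A \<union> {j})" by simp
      also have "\<dots> = ?\<chi> (A \<union> {})" using ij(3) by auto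
      finally show "U \<subseteq> ?\<chi> (A \<union> {})" .
    qed (use assms in auto)
    show "cocartesian (Pow V) (B - A) (face A ?\<chi>)"
      unfolding cocartesian_def face_def
    proof (rule isLubI)
      fix U
      assume U: "\<And>Y. Y \<in> (\<lambda>T. ?\<chi> (A \<union> T)) ` {S. S \<subset> B - A} \<Longrightarrow> Y \<le> U"
      show "?\<chi> (A \<union> (B - A)) \<subseteq> U"
      proof
        fix x assume x: "x \<in> ?\<chi> (A \<union> (B - A))"
        \<comment> \<open>This index set has at most one element (it is empty when
          \<open>g x\<close> is in \<open>A\<close>), so it cannot exhaust \<open>B - A\<close>, and
          its vertex still contains \<open>x\<close>.\<close>
        then have "{g x} - A \<subseteq> B - A" by auto
        moreover have "{g x} - A \<noteq> B - A" using ij by (metis Diff_iff singletonD)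
        ultimately have "{g x} - A \<subset> B - A" by simp
        then have "?\<chi> (A \<union> ({g x} - A)) \<subseteq> U" by (intro U imageI CollectI)
        then show "x \<in> U" using x by auto
      qed
    qed (use assms in auto)
  qed
  moreover have "cube (Pow V) J ?\<chi>"
    using assms by (auto simp: cube_def monotone_on_def)
  ultimately show ?thesis by (simp add: strongly_bicartesian_def)
qed

lemma finite_surj_atMost:
  assumes "finite \<sigma>" "n < card \<sigma>"
  obtains g :: "'a \<Rightarrow> nat" where "g ` \<sigma> = {..n}"
proof -
  obtain h where h: "bij_betw h \<sigma> {..<card \<sigma>}"
    using assms(1) finite_same_card_bij[of \<sigma> "{..<card \<sigma>}"] by auto
  \<comment> \<open>Truncating an enumeration at \<open>n\<close> puts all surplus points into the
    last block.\<close>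
  have "(\<lambda>x. min (h x) n) ` \<sigma> = (\<lambda>i. min i n) ` {..<card \<sigma>}"
    by (simp add: bij_betw_imp_surj_on[OF h, symmetric] image_image)
  also have "\<dots> = {..n}"
  proof (intro equalityI subsetI)
    fix i assume "i \<in> {..n}"
    then show "i \<in> (\<lambda>i. min i n) ` {..<card \<sigma>}"
      using assms(2) by (intro image_eqI[of _ _ i]) simp_all
  qed auto
  finally show thesis by (rule that)
qed

theorem mainTheorem9:
  fixes V :: "'a set" and X :: "'a set \<Rightarrow> bool" and n :: nat
  assumes "finite V"
    and "simplicial_complex V X"
    and "n \<ge> 1"
  shows "codegree (Pow V) n (opposite_functor X) \<longleftrightarrow> coskeletal V (n - 1) X"
proof -
  have X_down: "X \<tau>" if "X \<sigma>" "\<tau> \<subseteq> \<sigma>" "\<sigma> \<subseteq> V" for \<sigma> \<tau>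
    using assms(2) that unfolding simplicial_complex_def monotone_on_def
    by (metis Pow_iff le_boolE order_trans)
  then have mono: "mono_on (Pow V) (opposite_functor X)"
    by (auto simp: monotone_on_def opposite_functor_def)
  have "codegree (Pow V) n (opposite_functor X) \<longleftrightarrow>
      (\<forall>\<sigma>\<subseteq>V. (\<forall>\<tau>\<subseteq>\<sigma>. finite \<tau> \<and> card \<tau> \<le> n \<longrightarrow> X \<tau>) \<longrightarrow> X \<sigma>)" (is "_ \<longleftrightarrow> ?R")
  proof
    assume cod: "codegree (Pow V) n (opposite_functor X)"
    have "X \<sigma>" if "finite \<sigma>" "\<sigma> \<subseteq> V" "\<forall>\<tau>\<subseteq>\<sigma>. finite \<tau> \<and> card \<tau> \<le> n \<longrightarrow> X \<tau>" for \<sigma>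
      using that
    proof (induction \<sigma> rule: finite_psubset_induct)
      case (psubset \<sigma>)
      show ?case
      \<comment> \<open>A set of at most \<open>n\<close> points is one of its own test sets; only
        larger sets need a cube.\<close>
      proof (cases "card \<sigma> \<le> n")
        case False
        then obtain g where g: "g ` \<sigma> = {..n}"
          using finite_surj_atMost[of \<sigma> n] psubset.hyps by auto
        have "cocartesian UNIV {..n} (opposite_functor X \<circ> (\<lambda>S. \<sigma> \<inter> g -` S))"
          using cod strongly_bicartesian_vimage[OF psubset.prems(1)]
          unfolding codegree_def by blast
        then have "X (\<sigma> \<inter> g -` {..n}) \<longleftrightarrow> (\<forall>S\<subset>{..n}. X (\<sigma> \<inter> g -` S))"
          by (simp add: cocartesian_opposite_functor_iff)
        moreover have "X (\<sigma> \<inter> g -` S)" if S: "S \<subset> {..n}" for S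
        proof -
          \<comment> \<open>The block of a label \<open>i\<close> missing from \<open>S\<close> is
            nonempty, so the vertex at \<open>S\<close> is strictly smaller than
            \<open>\<sigma>\<close> and the induction hypothesis applies.\<close>
          obtain i where i: "i \<in> {..n}" "i \<notin> S" using psubset_imp_ex_mem[OF S] by auto
          then have "i \<in> g ` \<sigma>" using g by simp
          then obtain y where "y \<in> \<sigma>" "i = g y" by (rule imageE)
          with i have "\<sigma> \<inter> g -` S \<subset> \<sigma>" by auto
          then show ?thesis
            using psubset.prems by (intro psubset.IH) (meson Int_lower1 subset_trans)+
        qed
        moreover have "\<sigma> \<inter> g -` {..n} = \<sigma>"
          by (simp add: g[symmetric] Int_absorb2 subset_vimage_iff)
        ultimately show ?thesis by simp
      qed (use psubset.prems psubset.hyps in simp)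
    qed
    then show ?R using finite_subset[OF _ assms(1)] by simp
  next
    assume R: ?R
    have "X (\<chi> {..n}) \<longleftrightarrow> (\<forall>S\<subset>{..n}. X (\<chi> S))"
      if \<chi>: "strongly_bicartesian (Pow V) {..n} \<chi>" for \<chi>
    proof -
      have V: "\<chi> S \<subseteq> V" and mono: "\<chi> S \<subseteq> \<chi> {..n}" if "S \<subseteq> {..n}" for S
        using strongly_bicartesian_vertex[OF \<chi> that] strongly_bicartesian_mono[OF \<chi> that]
        by simp_all
      have "X (\<chi> {..n})" if *: "\<forall>S\<subset>{..n}. X (\<chi> S)"
      proof -
        have "X \<tau>" if \<tau>: "\<tau> \<subseteq> \<chi> {..n}" "finite \<tau>" "card \<tau> \<le> n" for \<tau>
        proof -
          obtain S where "S \<subset> {..n}" "\<tau> \<subseteq> \<chi> S"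
            using strongly_bicartesian_Pow_cover[OF \<chi> \<tau>] .
          then show ?thesis using * X_down[of "\<chi> S" \<tau>] V[of S] by simp
        qed
        \<comment> \<open>The coskeletal condition only tests subsets of at most \<open>n\<close>
          points, and each of these lies in a single earlier vertex.\<close>
        then show ?thesis using R V[OF subset_refl] by simp
      qed
      moreover have "X (\<chi> S)" if "X (\<chi> {..n})" "S \<subset> {..n}" for S
        using X_down[OF that(1) mono V] that(2) by simp
      ultimately show ?thesis by (intro iffI allI impI)
    qed
    then show "codegree (Pow V) n (opposite_functor X)"
      using mono by (simp add: codegree_def cocartesian_opposite_functor_iff)
  qed
  \<comment> \<open>Since \<open>n \<ge> 1\<close>, the bound \<open>(n - 1) + 1\<close> from the
    skeleton equals \<open>n\<close> despite truncated subtraction.\<close>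
  then show ?thesis
    using assms(3) by (simp add: coskeletal_iff[OF assms(2)])
qed

end
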